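(* There is an absolute constant $C>0$ with the following property. Let $g,h:\mathbb{R}^d\to\mathbb{R}$ be convex, $f=g-h$ with $f^*=\inf f>-\infty$, and let $h$ be $L_h$-smooth ($L_h>0$) with unbiased stochastic gradients of variance at most $\sigma^2$: $\mathbb{E}[\nabla h(x,\xi)]=\nabla h(x)$ and $\mathbb{E}\|\nabla h(x,\xi)-\nabla h(x)\|^2\le\sigma^2$ for all $x\in\mathbb{R}^d$. Run the stochastic proximal DC algorithm with momentum (defined in the context) for $T\ge1$ steps with constant parameters $\gamma_t=\gamma$, $\alpha_t=\sqrt6\,L_h\gamma$, $\delta_t=\delta\ge 0$. Let $$\phi_0:=\mathbb{E}[f(x_0)-f^*]+\frac{2}{\sqrt6\,L_h}\,\mathbb{E}\|m^h_0-\nabla h(x_0)\|^2 ,$$ assumed positive, and choose $\gamma=\min\Big(\frac{1}{\sqrt6\,L_h},\sqrt{\frac{\phi_0}{L_h\sigma^2T}}\Big)$ (the second entry being $+\infty$ if $\sigma=0$). Then $$\frac1T\sum_{t=0}^{T-1}\mathbb{E}\big[\|G_\gamma(x_t)\|^2\big]\le C\left(\sqrt{\frac{L_h\sigma^2\phi_0}{T}}+\frac{L_h\phi_0}{T}+\delta\right).$$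
   Context: Notation: $\operatorname{prox}_{\gamma g}(x)=\arg\min_y\{\gamma g(y)+\frac12\|y-x\|^2\}$, and the gradient surrogate is $G_\gamma(x)=\frac{1}{\gamma}\big(x-\operatorname{prox}_{\gamma g}(x+\gamma\nabla h(x))\big)$. "$L_h$-smooth" means differentiable with $L_h$-Lipschitz gradient. Stochastic proximal DC algorithm with momentum: $h(x)=\mathbb{E}_\xi[h(x,\xi)]$. Start from $x_0\in\mathbb{R}^d$; at each step $t$ draw a fresh sample $\xi_t$, independent of the past (in particular of $x_t$). Set $m^h_0=\nabla h(x_0,\xi_0)$ and $m^h_t=(1-\alpha_{t-1})m^h_{t-1}+\alpha_{t-1}\nabla h(x_t,\xi_t)$ for $t\ge1$. Let $$F_t(x)=g(x)+\frac{1}{2\gamma_t}\|x-x_t\|^2-h(x_t,\xi_t)-\langle m^h_t,x-x_t\rangle .$$ Then $x_{t+1}$ is any point with $F_t(x_{t+1})-\min_xF_t(x)\le\gamma_t\delta_t$. All expectations appearing are assumed finite. *)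

theory Defs
  imports "HOL-Probability.Probability"
begin

definition gradient :: "('a::real_inner \<Rightarrow> real) \<Rightarrow> 'a \<Rightarrow> 'a" where
  "gradient f x = (THE D. GDERIV f x :> D)"

definition smooth_with :: "real \<Rightarrow> ('a::real_inner \<Rightarrow> real) \<Rightarrow> bool" where
  "smooth_with L f \<longleftrightarrow> (\<forall>x. f differentiable (at x)) \<and> L-lipschitz_on UNIV (gradient f)"

definition prox :: "real \<Rightarrow> ('a::real_inner \<Rightarrow> real) \<Rightarrow> 'a \<Rightarrow> 'a" where
  "prox \<gamma> g x = (ARG_MIN (\<lambda>y. \<gamma> * g y + 1 / 2 * (norm (y - x))\<^sup>2) y. True)"

definition grad_surrogate ::
    "real \<Rightarrow> ('a::real_inner \<Rightarrow> real) \<Rightarrow> ('a \<Rightarrow> real) \<Rightarrow> 'a \<Rightarrow> 'a" where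
  "grad_surrogate \<gamma> g h x = (1 / \<gamma>) *\<^sub>R (x - prox \<gamma> g (x + \<gamma> *\<^sub>R gradient h x))"

(* The stochastic gradient is the gradient of h(., s) in its first argument. *)
definition stoch_grad :: "('a::real_inner \<Rightarrow> 's \<Rightarrow> real) \<Rightarrow> 'a \<Rightarrow> 's \<Rightarrow> 'a" where
  "stoch_grad H x s = gradient (\<lambda>y. H y s) x"

(* xs and ss are one realisation of the iterates and of the samples. *)
primrec momentum ::
    "('a::real_inner \<Rightarrow> 's \<Rightarrow> real) \<Rightarrow> (nat \<Rightarrow> real) \<Rightarrow> (nat \<Rightarrow> 'a) \<Rightarrow> (nat \<Rightarrow> 's) \<Rightarrow> nat \<Rightarrow> 'a" where
  "momentum H \<alpha> xs ss 0 = stoch_grad H (xs 0) (ss 0)"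
| "momentum H \<alpha> xs ss (Suc t) =
     (1 - \<alpha> t) *\<^sub>R momentum H \<alpha> xs ss t + \<alpha> t *\<^sub>R stoch_grad H (xs (Suc t)) (ss (Suc t))"

definition subproblem ::
    "('a::real_inner \<Rightarrow> real) \<Rightarrow> ('a \<Rightarrow> 's \<Rightarrow> real) \<Rightarrow> (nat \<Rightarrow> real) \<Rightarrow> (nat \<Rightarrow> real) \<Rightarrow>
     (nat \<Rightarrow> 'a) \<Rightarrow> (nat \<Rightarrow> 's) \<Rightarrow> nat \<Rightarrow> 'a \<Rightarrow> real" where
  "subproblem g H \<gamma> \<alpha> xs ss t x =
     g x + 1 / (2 * \<gamma> t) * (norm (x - xs t))\<^sup>2 - H (xs t) (ss t)
       - momentum H \<alpha> xs ss t \<bullet> (x - xs t)"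

(* Events generated by x_0, ..., x_t and by the samples drawn before step t.  The iterates are
   listed explicitly because the inexact minimiser x_{i+1} may be selected with extra randomness. *)
definition past_events ::
    "'w measure \<Rightarrow> 's measure \<Rightarrow> (nat \<Rightarrow> 'w \<Rightarrow> 'a::topological_space) \<Rightarrow> (nat \<Rightarrow> 'w \<Rightarrow> 's) \<Rightarrow> nat \<Rightarrow> 'w set set" where
  "past_events M D X \<xi> t = sigma_sets (space M)
     ({X i -` A \<inter> space M | i A. i \<le> t \<and> A \<in> sets borel} \<union>
      {\<xi> i -` A \<inter> space M | i A. i < t \<and> A \<in> sets D})"

(* A run of T steps on the probability space M; D is the common law of the samples. *)
definition stoch_prox_dc_run ::
    "'w measure \<Rightarrow> 's measure \<Rightarrow> ('a::euclidean_space \<Rightarrow> real) \<Rightarrow> ('a \<Rightarrow> 's \<Rightarrow> real) \<Rightarrow>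
     (nat \<Rightarrow> real) \<Rightarrow> (nat \<Rightarrow> real) \<Rightarrow> (nat \<Rightarrow> real) \<Rightarrow> nat \<Rightarrow>
     (nat \<Rightarrow> 'w \<Rightarrow> 'a) \<Rightarrow> (nat \<Rightarrow> 'w \<Rightarrow> 's) \<Rightarrow> bool" where
  "stoch_prox_dc_run M D g H \<gamma> \<alpha> \<delta> T X \<xi> \<longleftrightarrow>
     (\<forall>t\<le>T. X t \<in> borel_measurable M) \<and>
     (\<forall>t<T. \<xi> t \<in> measurable M D \<and> distr M D (\<xi> t) = D \<and>
        prob_space.indep_set M {\<xi> t -` A \<inter> space M | A. A \<in> sets D} (past_events M D X \<xi> t)) \<and>
     (\<forall>t<T. \<forall>\<omega>\<in>space M.
        let F = subproblem g H \<gamma> \<alpha> (\<lambda>i. X i \<omega>) (\<lambda>i. \<xi> i \<omega>) t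
        in F (X (Suc t) \<omega>) - (INF x. F x) \<le> \<gamma> t * \<delta> t)"

(* The absolute constant of the rate.  An existential constant inside a theorem could depend on
   the type variables, i.e. on the dimension and on the probability spaces; a closed real number
   cannot.  The value is not optimised. *)
definition dc_rate_const :: real where
  "dc_rate_const = 1000"

end

(* Write e t for the momentum error and X t for the iterates.  Strong convexity of the proximal
   subproblem bounds the squared gradient surrogate by the squared step, the squared error and delta,
   and convexity of h turns inexact minimality into a descent inequality for g - h that loses
   7/4 * gamma * |e t|^2.  A fresh sample is independent of the past, so conditionally on the past the
   new noise is centred and the mean squared error contracts by 1 - alpha, up to (L^2/alpha) times the
   squared step and alpha^2 * sigma^2.  With the weight c = 2/(sqrt 6 * L) one has c * alpha = 2 * gamma
   and c * L^2/alpha = 1/(3 * gamma) < 5/(14 * gamma), so E(g - h) + c * E|e t|^2 is a Lyapunov function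
   and its decrease pays for both the steps and the errors. *)
theory Submission
  imports Defs
begin

section \<open>Gradients and proximal points of convex functions\<close>

text \<open>\<open>gradient\<close> is a definite description, so existence and uniqueness both have
  to be supplied. The representing vector is assembled from the values of the derivative on
  \<open>Basis\<close>; two candidates agree because their difference is orthogonal to
  itself.\<close>

lemma GDERIV_gradient:
  fixes f :: "'a::euclidean_space \<Rightarrow> real"
  assumes "f differentiable (at x)"
  shows "GDERIV f x :> gradient f x"
proof -
  obtain f' where f': "(f has_derivative f') (at x)"
    using assms unfolding differentiable_def by blast
  interpret f': bounded_linear f'
    using f' by (rule has_derivative_bounded_linear)
  define d where "d = (\<Sum>b\<in>Basis. f' b *\<^sub>R b)"
  have "f' v = v \<bullet> d" for v
  proof -
    have "f' v = f' (\<Sum>b\<in>Basis. (v \<bullet> b) *\<^sub>R b)"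
      by (simp add: euclidean_representation)
    also have "\<dots> = (\<Sum>b\<in>Basis. (v \<bullet> b) * f' b)"
      by (simp add: f'.sum f'.scaleR)
    also have "\<dots> = v \<bullet> d"
      by (simp add: d_def inner_sum_right mult.commute)
    finally show ?thesis .
  qed
  then have d: "GDERIV f x :> d"
    using f' unfolding gderiv_def by (metis (no_types, lifting) ext)
  have "d' = d" if "GDERIV f x :> d'" for d'
  proof -
    have "(\<lambda>v. v \<bullet> d') = (\<lambda>v. v \<bullet> d)"
      using that d unfolding gderiv_def by (rule has_derivative_unique)
    then have "(d' - d) \<bullet> (d' - d) = 0"
      by (metis inner_diff_right right_minus_eq)
    then show ?thesis by simp
  qed
  with d show ?thesis
    unfolding gradient_def by (rule theI)
qed

lemma DERIV_along_line:
  fixes f :: "'a::euclidean_space \<Rightarrow> real"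
  assumes "f differentiable (at x)"
  shows "((\<lambda>s. f (x + s *\<^sub>R v)) has_field_derivative gradient f x \<bullet> v) (at 0)"
proof -
  have 1: "(f has_derivative (\<lambda>w. w \<bullet> gradient f x)) (at (x + 0 *\<^sub>R v))"
    using GDERIV_gradient[OF assms] by (simp add: gderiv_def)
  have 2: "((\<lambda>s. x + s *\<^sub>R v) has_derivative (\<lambda>s. s *\<^sub>R v)) (at 0)"
    by (auto intro!: derivative_eq_intros)
  have "((\<lambda>s. f (x + s *\<^sub>R v)) has_derivative (\<lambda>s. (s *\<^sub>R v) \<bullet> gradient f x)) (at 0)"
    by (rule has_derivative_compose[OF 2 1])
  then show ?thesis
    by (simp add: has_field_derivative_def inner_commute mult_commute_abs)
qed

text \<open>Restriction to the line through \<open>x\<close> and \<open>y\<close> reduces the claim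
  to a convex function of one variable lying above its tangents.\<close>

lemma convex_gradient_ineq:
  fixes f :: "'a::euclidean_space \<Rightarrow> real"
  assumes "convex_on UNIV f" and "f differentiable (at x)"
  shows "f x + gradient f x \<bullet> (y - x) \<le> f y"
proof -
  define q where "q = (\<lambda>s::real. f (x + s *\<^sub>R (y - x)))"
  have "convex_on UNIV q"
  proof (rule convex_onI)
    fix t a b :: real
    assume t: "0 < t" "t < 1"
    have "x + ((1 - t) *\<^sub>R a + t *\<^sub>R b) *\<^sub>R (y - x)
        = (1 - t) *\<^sub>R (x + a *\<^sub>R (y - x)) + t *\<^sub>R (x + b *\<^sub>R (y - x))"
      by (simp add: algebra_simps)
    then show "q ((1 - t) *\<^sub>R a + t *\<^sub>R b) \<le> (1 - t) * q a + t * q b"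
      using convex_onD[OF assms(1), of t "x + a *\<^sub>R (y - x)" "x + b *\<^sub>R (y - x)"] t
      by (simp add: q_def)
  qed simp
  moreover have "(q has_field_derivative gradient f x \<bullet> (y - x)) (at 0)"
    unfolding q_def by (rule DERIV_along_line[OF assms(2)])
  ultimately have "q 1 - q 0 \<ge> gradient f x \<bullet> (y - x) * (1 - 0)"
    by (intro convex_on_imp_above_tangent) auto
  then show ?thesis
    by (simp add: q_def)
qed

text \<open>Needed for coercivity of the proximal objective: a convex function falls at most
  linearly and so loses against a quadratic. By continuity \<open>g\<close> is bounded by some
  \<open>B\<close> on the unit ball around \<open>x\<close>, and a faster decrease further out would
  by convexity force it below \<open>- B\<close> on the unit sphere.\<close>

lemma convex_linear_lower_bound:
  fixes g :: "'a::euclidean_space \<Rightarrow> real"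
  assumes "convex_on UNIV g"
  obtains K where "K \<ge> 0" and "\<And>y. g x - K * (1 + norm (y - x)) \<le> g y"
proof -
  have "continuous_on (cball x 1) g"
    by (rule continuous_on_subset[OF convex_on_continuous[OF open_UNIV assms]]) simp
  then have "bounded (g ` cball x 1)"
    by (intro compact_imp_bounded compact_continuous_image) simp_all
  then obtain B where B: "\<And>u. u \<in> cball x 1 \<Longrightarrow> \<bar>g u\<bar> \<le> B"
    unfolding bounded_real by blast
  have B0: "\<bar>g x\<bar> \<le> B" using B[of x] by simp
  show thesis
  proof
    show "0 \<le> 2 * B" using B0 by simp
    fix y
    define r where "r = norm (y - x)"
    show "g x - 2 * B * (1 + norm (y - x)) \<le> g y"
    proof (cases "r \<le> 1")
      case True
      then have "\<bar>g y\<bar> \<le> B"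
        by (intro B) (simp add: r_def dist_norm norm_minus_commute)
      moreover have "0 \<le> 2 * B * r" using B0 by (simp add: r_def)
      ultimately show ?thesis using B0 by (simp add: algebra_simps r_def[symmetric])
    next
      case False
      then have r0: "r \<noteq> 0" by simp
      \<comment> \<open>The point where the segment from \<open>x\<close> to \<open>y\<close>
        crosses the unit sphere around \<open>x\<close>.\<close>
      define u where "u = (1 - 1 / r) *\<^sub>R x + (1 / r) *\<^sub>R y"
      have "u - x = (1 / r) *\<^sub>R (y - x)" by (simp add: u_def algebra_simps)
      then have "norm (u - x) = 1" using False by (auto simp: r_def)
      then have "\<bar>g u\<bar> \<le> B"
        by (intro B) (simp add: dist_norm norm_minus_commute)
      moreover have "g u \<le> (1 - 1 / r) * g x + (1 / r) * g y"
        unfolding u_def using False by (intro convex_onD[OF assms]) auto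
      then have "r * g u \<le> r * ((1 - 1 / r) * g x + (1 / r) * g y)"
        using False by (intro mult_left_mono) auto
      then have "r * g u \<le> (r - 1) * g x + g y"
        using r0 by (simp add: distrib_left right_diff_distrib left_diff_distrib flip: mult.assoc)
      moreover have "r * g u \<ge> r * (- B)"
        using False \<open>\<bar>g u\<bar> \<le> B\<close> by (intro mult_left_mono) auto
      moreover have "r * g x \<le> r * B"
        using False B0 by (intro mult_left_mono) auto
      ultimately show ?thesis
        using B0 by (simp add: algebra_simps r_def[symmetric])
    qed
  qed
qed

text \<open>\<open>prox\<close> is a choice of minimiser, so it minimises as soon as some minimiser
  exists. One exists on a large ball by compactness, and outside that ball the objective already
  exceeds its value at the centre \<open>x\<close>.\<close>

lemma prox_minimizes:
  fixes g :: "'a::euclidean_space \<Rightarrow> real"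
  assumes "convex_on UNIV g" and "\<gamma> > 0"
  shows "\<gamma> * g (prox \<gamma> g x) + 1 / 2 * (norm (prox \<gamma> g x - x))\<^sup>2
           \<le> \<gamma> * g y + 1 / 2 * (norm (y - x))\<^sup>2"
proof -
  define q where "q = (\<lambda>y. \<gamma> * g y + 1 / 2 * (norm (y - x))\<^sup>2)"
  obtain K where K: "K \<ge> 0" "\<And>y. g x - K * (1 + norm (y - x)) \<le> g y"
    using convex_linear_lower_bound[OF assms(1)] by blast
  \<comment> \<open>At distance \<open>r > R\<close> half the squared distance is at least
    \<open>r / 2 + 2 * \<gamma> * K * r\<close>, which beats the possible loss
    \<open>\<gamma> * K * (1 + r)\<close> from the linear lower bound because
    \<open>r \<ge> 1\<close>.\<close>
  define R where "R = 1 + 4 * \<gamma> * K"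
  have R: "R \<ge> 1" using K assms by (simp add: R_def)
  have "continuous_on (cball x R) g"
    by (rule continuous_on_subset[OF convex_on_continuous[OF open_UNIV assms(1)]]) simp
  then have "continuous_on (cball x R) q"
    unfolding q_def by (intro continuous_intros)
  then obtain p where p: "p \<in> cball x R" "\<And>y. y \<in> cball x R \<Longrightarrow> q p \<le> q y"
    using continuous_attains_inf[of "cball x R" q] R by auto
  have "q p \<le> q y" for y
  proof (cases "y \<in> cball x R")
    case False
    define r where "r = norm (y - x)"
    have r: "r > R" using False by (simp add: r_def dist_norm norm_minus_commute)
    have "\<gamma> * (g x - K * (1 + r)) \<le> \<gamma> * g y"
      using K(2)[of y] assms(2) by (simp add: r_def)
    moreover have "R * r \<le> r\<^sup>2"
      using r R by (simp add: power2_eq_square)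
    then have "r + 4 * (\<gamma> * K * r) \<le> r\<^sup>2"
      by (simp add: R_def algebra_simps)
    moreover have "\<gamma> * K * 1 \<le> \<gamma> * K * r"
      using r R K assms by (intro mult_left_mono) auto
    ultimately have "\<gamma> * g x \<le> q y"
      using r R by (simp add: q_def r_def[symmetric] algebra_simps)
    moreover have "q p \<le> q x" using R by (intro p) auto
    ultimately show ?thesis by (simp add: q_def)
  qed (rule p)
  then have "is_arg_min q (\<lambda>_. True) p"
    by (simp add: is_arg_min_linorder)
  then have "is_arg_min q (\<lambda>_. True) (prox \<gamma> g x)"
    unfolding prox_def arg_min_def q_def[symmetric] by (rule someI)
  then show ?thesis
    by (simp add: is_arg_min_linorder q_def)
qed

text \<open>The exact form of strong convexity of the squared distance; the last term is the surplus
  over plain convexity.\<close>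

lemma norm_segment_square:
  fixes p x y :: "'a::real_inner"
  shows "(norm ((1 - s) *\<^sub>R p + s *\<^sub>R y - x))\<^sup>2
    = (1 - s) * (norm (p - x))\<^sup>2 + s * (norm (y - x))\<^sup>2 - s * (1 - s) * (norm (y - p))\<^sup>2"
proof -
  define u v where "u = p - x" and "v = y - x"
  have "(1 - s) *\<^sub>R p + s *\<^sub>R y - x = (1 - s) *\<^sub>R u + s *\<^sub>R v" and "y - p = v - u"
    by (simp_all add: u_def v_def algebra_simps)
  moreover have "(norm ((1 - s) *\<^sub>R u + s *\<^sub>R v))\<^sup>2
      = (1 - s)\<^sup>2 * (u \<bullet> u) + 2 * s * (1 - s) * (u \<bullet> v) + s\<^sup>2 * (v \<bullet> v)"
    unfolding power2_norm_eq_inner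
    by (simp add: inner_add_left inner_add_right inner_commute[of v u]) algebra
  moreover have "(norm (v - u))\<^sup>2 = v \<bullet> v - 2 * (u \<bullet> v) + u \<bullet> u"
    unfolding power2_norm_eq_inner
    by (simp add: inner_diff_left inner_diff_right inner_commute[of v u])
  ultimately show ?thesis
    by (simp add: u_def[symmetric] v_def[symmetric] power2_norm_eq_inner)
      (simp add: power2_eq_square algebra_simps)
qed

text \<open>The half squared distance makes the objective 1-strongly convex. Comparing the minimiser
  with points of the segment towards \<open>y\<close>, dividing by the segment parameter
  \<open>s\<close> and letting \<open>s\<close> tend to 0 leaves the quadratic growth term.\<close>

lemma prox_strongly_minimizes:
  fixes g :: "'a::euclidean_space \<Rightarrow> real"
  assumes "convex_on UNIV g" and "\<gamma> > 0"
  shows "\<gamma> * g (prox \<gamma> g x) + 1 / 2 * (norm (prox \<gamma> g x - x))\<^sup>2 + 1 / 2 * (norm (y - prox \<gamma> g x))\<^sup>2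
           \<le> \<gamma> * g y + 1 / 2 * (norm (y - x))\<^sup>2"
proof -
  define p where "p = prox \<gamma> g x"
  define q where "q = (\<lambda>y. \<gamma> * g y + 1 / 2 * (norm (y - x))\<^sup>2)"
  have "1 / 2 * (norm (y - p))\<^sup>2 \<le> q y - q p"
  \<comment> \<open>The rule takes the place of the limit: the bound with a factor
    \<open>z = 1 - s\<close> for every \<open>z\<close> strictly between 0 and 1 suffices.\<close>
  proof (rule field_le_mult_one_interval)
    fix z :: real
    assume z: "0 < z" "z < 1"
    define s where "s = 1 - z"
    have s: "0 < s" "s < 1" using z by (auto simp: s_def)
    have "g ((1 - s) *\<^sub>R p + s *\<^sub>R y) \<le> (1 - s) * g p + s * g y"
      using s by (intro convex_onD[OF assms(1)]) auto
    then have "\<gamma> * g ((1 - s) *\<^sub>R p + s *\<^sub>R y) \<le> \<gamma> * ((1 - s) * g p + s * g y)"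
      using assms(2) by simp
    moreover have "q p \<le> q ((1 - s) *\<^sub>R p + s *\<^sub>R y)"
      unfolding q_def p_def by (rule prox_minimizes[OF assms])
    moreover have "(1 - s) * (norm (p - x))\<^sup>2 + s * (norm (y - x))\<^sup>2 - s * (1 - s) * (norm (y - p))\<^sup>2
        = (norm ((1 - s) *\<^sub>R p + s *\<^sub>R y - x))\<^sup>2"
      by (simp only: norm_segment_square)
    ultimately have "s * (1 / 2 * (1 - s) * (norm (y - p))\<^sup>2) \<le> s * (q y - q p)"
      unfolding q_def right_diff_distrib distrib_left left_diff_distrib by simp argo
    then have "1 / 2 * (1 - s) * (norm (y - p))\<^sup>2 \<le> q y - q p"
      using s by simp
    then show "z * (1 / 2 * (norm (y - p))\<^sup>2) \<le> q y - q p"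
      by (simp add: s_def algebra_simps)
  qed
  then show ?thesis by (simp add: q_def p_def)
qed

text \<open>Adding strong minimality of each proximal point, tested against the other one, gives
  firm nonexpansiveness; Cauchy-Schwarz does the rest.\<close>

lemma prox_nonexpansive:
  fixes g :: "'a::euclidean_space \<Rightarrow> real"
  assumes "convex_on UNIV g" and "\<gamma> > 0"
  shows "norm (prox \<gamma> g a - prox \<gamma> g b) \<le> norm (a - b)"
proof -
  define p q where "p = prox \<gamma> g a" and "q = prox \<gamma> g b"
  have "(norm (p - q))\<^sup>2 \<le> (a - b) \<bullet> (p - q)"
    using prox_strongly_minimizes[OF assms, of a q] prox_strongly_minimizes[OF assms, of b p]
    by (simp add: p_def[symmetric] q_def[symmetric] power2_norm_eq_inner inner_diff_left
        inner_diff_right inner_commute algebra_simps)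
  also have "\<dots> \<le> norm (a - b) * norm (p - q)"
    by (rule norm_cauchy_schwarz)
  finally have "norm (p - q) * norm (p - q) \<le> norm (a - b) * norm (p - q)"
    by (simp add: power2_eq_square)
  then have "norm (p - q) \<le> norm (a - b)"
    by (cases "p = q") auto
  then show ?thesis by (simp add: p_def q_def)
qed

section \<open>Fresh samples\<close>

text \<open>Joint measurability is inherited from \<open>H\<close>: every directional component of
  the gradient is a pointwise limit of measurable difference quotients along the null sequence
  \<open>r\<close>.\<close>

lemma borel_measurable_stoch_grad:
  fixes H :: "'a::euclidean_space \<Rightarrow> 's \<Rightarrow> real"
  assumes H: "(\<lambda>(x, s). H x s) \<in> borel_measurable (borel \<Otimes>\<^sub>M D)"
    and diff: "\<And>x s. s \<in> space D \<Longrightarrow> (\<lambda>y. H y s) differentiable (at x)"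
  shows "(\<lambda>(x, s). stoch_grad H x s) \<in> borel_measurable (borel \<Otimes>\<^sub>M D)"
proof -
  have "(\<lambda>z. stoch_grad H (fst z) (snd z) \<bullet> b) \<in> borel_measurable (borel \<Otimes>\<^sub>M D)" for b :: 'a
  proof (rule borel_measurable_LIMSEQ_real)
    define r where "r = (\<lambda>n. inverse (real (Suc n)))"
    define q where "q = (\<lambda>n z. (H (fst z + r n *\<^sub>R b) (snd z) - H (fst z) (snd z)) / r n)"
    show "q n \<in> borel_measurable (borel \<Otimes>\<^sub>M D)" for n
    proof -
      have "(\<lambda>z. H (fst z + c) (snd z)) \<in> borel_measurable (borel \<Otimes>\<^sub>M D)" for c
      proof -
        have "(\<lambda>z. (fst z + c, snd z)) \<in> measurable (borel \<Otimes>\<^sub>M D) (borel \<Otimes>\<^sub>M D)"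
          by measurable
        from measurable_compose[OF this H] show ?thesis
          by simp
      qed
      from this[of "r n *\<^sub>R b"] this[of 0] show ?thesis
        unfolding q_def by simp
    qed
    show "(\<lambda>n. q n z) \<longlonglongrightarrow> stoch_grad H (fst z) (snd z) \<bullet> b"
      if z: "z \<in> space (borel \<Otimes>\<^sub>M D)" for z
    proof -
      have "(\<lambda>y. H y (snd z)) differentiable (at (fst z))"
        using z by (intro diff) (auto simp: space_pair_measure)
      from DERIV_along_line[OF this, of b]
      have "((\<lambda>t. (H (fst z + t *\<^sub>R b) (snd z) - H (fst z) (snd z)) / t)
          \<longlongrightarrow> stoch_grad H (fst z) (snd z) \<bullet> b) (at 0)"
        by (simp add: DERIV_def stoch_grad_def)
      moreover have "filterlim r (at 0) sequentially"
        unfolding filterlim_at r_def using LIMSEQ_inverse_real_of_nat by simp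
      ultimately show ?thesis
        unfolding q_def by (rule filterlim_compose)
    qed
  qed
  then show ?thesis
    by (subst borel_measurable_euclidean_space) (simp add: case_prod_beta)
qed

text \<open>\<open>N\<close> is left general because the lemma is applied both to the full
  probability space and to the sigma-algebra of the past.\<close>

lemma borel_measurable_momentum:
  fixes H :: "'a::euclidean_space \<Rightarrow> 's \<Rightarrow> real"
  assumes G: "(\<lambda>(x, s). stoch_grad H x s) \<in> borel_measurable (borel \<Otimes>\<^sub>M D)"
    and "\<And>i. i \<le> t \<Longrightarrow> X i \<in> borel_measurable N" and "\<And>i. i \<le> t \<Longrightarrow> \<xi> i \<in> measurable N D"
  shows "(\<lambda>\<omega>. momentum H \<alpha> (\<lambda>i. X i \<omega>) (\<lambda>i. \<xi> i \<omega>) t) \<in> borel_measurable N"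
  using assms(2,3)
proof (induction t)
  have grad: "(\<lambda>\<omega>. stoch_grad H (X i \<omega>) (\<xi> i \<omega>)) \<in> borel_measurable N"
    if "X i \<in> borel_measurable N" and "\<xi> i \<in> measurable N D" for i
    using measurable_compose[OF measurable_Pair[OF that] G] by simp
  {
    case 0
    then show ?case by (simp add: grad)
  next
    case (Suc t)
    then show ?case by (auto intro!: borel_measurable_add borel_measurable_scaleR grad)
  }
qed

text \<open>A substitute for conditional expectation given the past \<open>F\<close>: independence
  makes the joint law of the outcome, seen through \<open>F\<close>, and of the sample a product, so
  by Tonelli the sample is integrated out with the past frozen. Nonnegative integrals avoid any
  prior integrability of \<open>k\<close>.\<close>

lemma (in prob_space) nn_integral_independent_pair:
  assumes D: "prob_space D" and spF: "space F = space M"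
    and \<xi>: "\<xi> \<in> measurable M D" and law: "distr M D \<xi> = D"
    and indep: "indep_set {\<xi> -` A \<inter> space M | A. A \<in> sets D} (sets F)"
    and k: "k \<in> borel_measurable (F \<Otimes>\<^sub>M D)"
  shows "(\<integral>\<^sup>+ \<omega>. k (\<omega>, \<xi> \<omega>) \<partial>M) = (\<integral>\<^sup>+ \<omega>. \<integral>\<^sup>+ s. k (\<omega>, s) \<partial>D \<partial>M)"
proof -
  have sub: "sets F \<subseteq> events"
    using indep by (rule indep_setD_ev2)
  have idF: "(\<lambda>\<omega>. \<omega>) \<in> measurable M F"
    using sub spF by (auto simp: measurable_def dest: sets.sets_into_space intro: Int_absorb2)
  have pair: "(\<lambda>\<omega>. (\<omega>, \<xi> \<omega>)) \<in> measurable M (F \<Otimes>\<^sub>M D)"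
    using idF \<xi> by (rule measurable_Pair)
  interpret D: prob_space D by (rule D)
  interpret F: prob_space "distr M F (\<lambda>\<omega>. \<omega>)"
    using idF by (rule prob_space_distr)
  \<comment> \<open>Only measurable rectangles need checking, and there the equality is the assumed
    independence.\<close>
  have prod: "distr M F (\<lambda>\<omega>. \<omega>) \<Otimes>\<^sub>M D = distr M (F \<Otimes>\<^sub>M D) (\<lambda>\<omega>. (\<omega>, \<xi> \<omega>))"
  proof (rule pair_measure_eqI)
    show "sigma_finite_measure (distr M F (\<lambda>\<omega>. \<omega>))" "sigma_finite_measure D"
      by unfold_locales
    show "sets (distr M F (\<lambda>\<omega>. \<omega>) \<Otimes>\<^sub>M D) = sets (distr M (F \<Otimes>\<^sub>M D) (\<lambda>\<omega>. (\<omega>, \<xi> \<omega>)))"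
      by (simp cong: sets_pair_measure_cong)
    fix A B
    assume "A \<in> sets (distr M F (\<lambda>\<omega>. \<omega>))" and B: "B \<in> sets D"
    then have A: "A \<in> sets F" by simp
    have AM: "(\<lambda>\<omega>. \<omega>) -` A \<inter> space M = A"
      using sets.sets_into_space[OF A] spF by auto
    have "emeasure D B = emeasure (distr M D \<xi>) B" by (simp add: law)
    also have "\<dots> = prob (\<xi> -` B \<inter> space M)"
      using \<xi> B by (simp add: emeasure_distr emeasure_eq_measure)
    finally have 1: "emeasure D B = prob (\<xi> -` B \<inter> space M)" .
    have 2: "emeasure (distr M F (\<lambda>\<omega>. \<omega>)) A = prob A"
      unfolding emeasure_distr[OF idF A] AM by (rule emeasure_eq_measure)
    have "(\<lambda>\<omega>. (\<omega>, \<xi> \<omega>)) -` (A \<times> B) \<inter> space M = (\<xi> -` B \<inter> space M) \<inter> A"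
      using sets.sets_into_space[OF A] spF by auto
    then have "emeasure (distr M (F \<Otimes>\<^sub>M D) (\<lambda>\<omega>. (\<omega>, \<xi> \<omega>))) (A \<times> B) = prob ((\<xi> -` B \<inter> space M) \<inter> A)"
      using pair A B by (simp add: emeasure_distr emeasure_eq_measure)
    also have "\<dots> = prob (\<xi> -` B \<inter> space M) * prob A"
      using A B by (subst indep_setD[OF indep]) auto
    finally show "emeasure (distr M F (\<lambda>\<omega>. \<omega>)) A * emeasure D B
        = emeasure (distr M (F \<Otimes>\<^sub>M D) (\<lambda>\<omega>. (\<omega>, \<xi> \<omega>))) (A \<times> B)"
      unfolding 1 2 by (simp add: ennreal_mult mult.commute)
  qed
  have k': "k \<in> borel_measurable (distr M F (\<lambda>\<omega>. \<omega>) \<Otimes>\<^sub>M D)"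
    using k by (simp cong: measurable_cong_sets sets_pair_measure_cong)
  have "(\<integral>\<^sup>+ \<omega>. k (\<omega>, \<xi> \<omega>) \<partial>M) = integral\<^sup>N (distr M (F \<Otimes>\<^sub>M D) (\<lambda>\<omega>. (\<omega>, \<xi> \<omega>))) k"
    using pair k by (simp add: nn_integral_distr)
  also have "\<dots> = (\<integral>\<^sup>+ \<omega>. \<integral>\<^sup>+ s. k (\<omega>, s) \<partial>D \<partial>distr M F (\<lambda>\<omega>. \<omega>))"
    unfolding prod[symmetric] using D.nn_integral_fst[OF k'] by simp
  also have "\<dots> = (\<integral>\<^sup>+ \<omega>. \<integral>\<^sup>+ s. k (\<omega>, s) \<partial>D \<partial>M)"
    using idF D.borel_measurable_nn_integral_fst[OF k] by (intro nn_integral_distr) simp_all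
  finally show ?thesis .
qed

lemma (in prob_space) nn_integral_norm_add_centered:
  fixes n :: "'a \<Rightarrow> 'b::euclidean_space"
  assumes n: "integrable M n" and "(\<integral>s. n s \<partial>M) = 0"
    and n2: "integrable M (\<lambda>s. (norm (n s))\<^sup>2)" and var: "(\<integral>s. (norm (n s))\<^sup>2 \<partial>M) \<le> v"
  shows "(\<integral>\<^sup>+ s. ennreal ((norm (A + c *\<^sub>R n s))\<^sup>2) \<partial>M) \<le> ennreal ((norm A)\<^sup>2 + c\<^sup>2 * v)"
proof -
  have eq: "(norm (A + c *\<^sub>R n s))\<^sup>2 = (norm A)\<^sup>2 + 2 * c * (A \<bullet> n s) + c\<^sup>2 * (norm (n s))\<^sup>2" for s
    unfolding power2_norm_eq_inner
    by (simp add: inner_add_left inner_add_right inner_commute[of "n s" A] power2_eq_square algebra_simps)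
  have int: "integrable M (\<lambda>s. (norm A)\<^sup>2 + 2 * c * (A \<bullet> n s) + c\<^sup>2 * (norm (n s))\<^sup>2)"
    using n n2 by (intro Bochner_Integration.integrable_add integrable_mult_right
        integrable_inner_right integrable_const) auto
  have "(\<integral>s. (norm A)\<^sup>2 + 2 * c * (A \<bullet> n s) + c\<^sup>2 * (norm (n s))\<^sup>2 \<partial>M)
      = (norm A)\<^sup>2 + 2 * c * (A \<bullet> (\<integral>s. n s \<partial>M)) + c\<^sup>2 * (\<integral>s. (norm (n s))\<^sup>2 \<partial>M)"
    using n n2 by (simp add: prob_space)
  also have "\<dots> \<le> (norm A)\<^sup>2 + c\<^sup>2 * v"
    using assms(2) var by (simp add: mult_left_mono)
  finally show ?thesis
    using int unfolding eq[symmetric] by (subst nn_integral_eq_integral) (auto intro: ennreal_leI)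
qed

section \<open>One step, and the Lyapunov sum\<close>

text \<open>Up to the factor \<open>\<gamma>\<close> and an additive constant, \<open>F\<close> is
  the proximal objective at \<open>x + \<gamma> *\<^sub>R m\<close>. Its exact minimiser is the
  proximal point, and strong convexity turns near-optimality of the value into nearness of
  \<open>z\<close> to that point. The constant \<open>c\<close> stands for the sampled value of the
  objective part \<open>h\<close>.\<close>

lemma inexact_prox_step:
  fixes g :: "'a::euclidean_space \<Rightarrow> real" and x m z :: 'a and c \<gamma> \<delta> :: real
  defines "F \<equiv> \<lambda>y. g y + 1 / (2 * \<gamma>) * (norm (y - x))\<^sup>2 - c - m \<bullet> (y - x)"
  assumes g: "convex_on UNIV g" and \<gamma>: "\<gamma> > 0"
    and z: "F z - (INF y. F y) \<le> \<gamma> * \<delta>"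
  shows inexact_prox_step_le: "F z \<le> F y + \<gamma> * \<delta>"
    and inexact_prox_step_near: "(norm (z - prox \<gamma> g (x + \<gamma> *\<^sub>R m)))\<^sup>2 \<le> 2 * \<gamma>\<^sup>2 * \<delta>"
proof -
  define p where "p = prox \<gamma> g (x + \<gamma> *\<^sub>R m)"
  have scaled: "\<gamma> * F y = \<gamma> * g y + 1 / 2 * (norm (y - (x + \<gamma> *\<^sub>R m)))\<^sup>2 - 1 / 2 * \<gamma>\<^sup>2 * (m \<bullet> m) - \<gamma> * c" for y
  proof -
    define v where "v = y - x"
    have "y - (x + \<gamma> *\<^sub>R m) = v - \<gamma> *\<^sub>R m"
      by (simp add: v_def)
    then have "(norm (y - (x + \<gamma> *\<^sub>R m)))\<^sup>2 = (norm (v - \<gamma> *\<^sub>R m))\<^sup>2"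
      by (simp only:)
    moreover have "(norm (v - \<gamma> *\<^sub>R m))\<^sup>2 = (norm v)\<^sup>2 - 2 * \<gamma> * (m \<bullet> v) + \<gamma>\<^sup>2 * (m \<bullet> m)"
      unfolding power2_norm_eq_inner
      by (simp add: inner_diff_left inner_diff_right inner_commute[of v m] power2_eq_square algebra_simps)
    moreover have "\<gamma> * F y = \<gamma> * g y + 1 / 2 * (norm v)\<^sup>2 - \<gamma> * c - \<gamma> * (m \<bullet> v)"
      using \<gamma> unfolding F_def v_def[symmetric] by (simp add: field_simps)
    ultimately show ?thesis by (simp add: add_divide_distrib diff_divide_distrib)
  qed
  have strong: "\<gamma> * F p + 1 / 2 * (norm (y - p))\<^sup>2 \<le> \<gamma> * F y" for y
    using prox_strongly_minimizes[OF g \<gamma>, of "x + \<gamma> *\<^sub>R m" y]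
    by (simp add: scaled p_def)
  have "F p \<le> F y" for y
  proof -
    have "\<gamma> * F p \<le> \<gamma> * F y"
      using strong[of y] zero_le_power2[of "norm (y - p)"] by linarith
    then show ?thesis using \<gamma> by simp
  qed
  \<comment> \<open>A real-valued \<open>INF\<close> is a lower bound only for a set bounded below;
    after this the hypothesis on \<open>F z\<close> expresses approximate minimality.\<close>
  then have "bdd_below (range F)"
    by (auto intro!: bdd_belowI)
  then have "(INF y. F y) \<le> F y" for y
    by (rule cINF_lower) simp
  then have le: "F z \<le> F y + \<gamma> * \<delta>" for y
    using z by (smt (verit))
  show "F z \<le> F y + \<gamma> * \<delta>" by (rule le)
  have "\<gamma> * F z \<le> \<gamma> * (F p + \<gamma> * \<delta>)"
    using le[of p] \<gamma> by (intro mult_left_mono) auto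
  then show "(norm (z - prox \<gamma> g (x + \<gamma> *\<^sub>R m)))\<^sup>2 \<le> 2 * \<gamma>\<^sup>2 * \<delta>"
    using strong[of z] unfolding p_def[symmetric] by (simp add: power2_eq_square algebra_simps)
qed

text \<open>\<open>z\<close> is compared with staying at \<open>x\<close>, and convexity bounds
  \<open>h z\<close> below by the tangent of \<open>h\<close> at \<open>x\<close>. What remains is
  the inner product of the gradient error \<open>e\<close> with the step \<open>v\<close>.\<close>

lemma inexact_prox_step_descent:
  fixes g h :: "'a::euclidean_space \<Rightarrow> real" and x m z :: 'a and c \<gamma> \<delta> :: real
  defines "F \<equiv> \<lambda>y. g y + 1 / (2 * \<gamma>) * (norm (y - x))\<^sup>2 - c - m \<bullet> (y - x)"
  assumes g: "convex_on UNIV g" and \<gamma>: "\<gamma> > 0"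
    and h: "convex_on UNIV h" "h differentiable (at x)"
    and z: "F z - (INF y. F y) \<le> \<gamma> * \<delta>"
  shows "g z - h z + 5 / (14 * \<gamma>) * (norm (z - x))\<^sup>2
    \<le> g x - h x + 7 / 4 * \<gamma> * (norm (m - gradient h x))\<^sup>2 + \<gamma> * \<delta>"
proof -
  define v e where "v = z - x" and "e = m - gradient h x"
  have "g z + 1 / (2 * \<gamma>) * (norm v)\<^sup>2 - m \<bullet> v \<le> g x + \<gamma> * \<delta>"
    using inexact_prox_step_le[OF g \<gamma> z[unfolded F_def], of x] by (simp add: v_def)
  moreover have "h x + gradient h x \<bullet> v \<le> h z"
    using convex_gradient_ineq[OF h] by (simp add: v_def)
  moreover have "m \<bullet> v = e \<bullet> v + gradient h x \<bullet> v"
    by (simp add: e_def inner_diff_left)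
  \<comment> \<open>Young's inequality with weight \<open>k * \<gamma>\<close> on the squared error
    leaves \<open>1 / 2 - 1 / (4 * k)\<close> for the step. The Lyapunov argument needs
    \<open>k < 2\<close> and a remainder above \<open>1 / 3\<close>, that is
    \<open>k > 3 / 2\<close>; the midpoint \<open>k = 7 / 4\<close> gives
    \<open>5 / 14\<close>.\<close>
  moreover have "e \<bullet> v \<le> 7 / 4 * \<gamma> * (norm e)\<^sup>2 + 1 / (7 * \<gamma>) * (norm v)\<^sup>2"
  proof -
    have "(norm (v - (7 * \<gamma> / 2) *\<^sub>R e))\<^sup>2 = (norm v)\<^sup>2 - 7 * \<gamma> * (e \<bullet> v) + 49 / 4 * \<gamma>\<^sup>2 * (norm e)\<^sup>2"
      unfolding power2_norm_eq_inner
      by (simp add: inner_diff_left inner_diff_right inner_commute[of v e] power2_eq_square algebra_simps)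
    then have "7 * \<gamma> * (e \<bullet> v) \<le> (norm v)\<^sup>2 + 49 / 4 * \<gamma>\<^sup>2 * (norm e)\<^sup>2"
      using zero_le_power2[of "norm (v - (7 * \<gamma> / 2) *\<^sub>R e)"] by linarith
    also have "\<dots> = 7 * \<gamma> * (7 / 4 * \<gamma> * (norm e)\<^sup>2 + 1 / (7 * \<gamma>) * (norm v)\<^sup>2)"
      using \<gamma> by (simp add: field_simps power2_eq_square)
    finally show ?thesis using \<gamma> by simp
  qed
  moreover have "1 / (2 * \<gamma>) * (norm v)\<^sup>2 - 1 / (7 * \<gamma>) * (norm v)\<^sup>2 = 5 / (14 * \<gamma>) * (norm v)\<^sup>2"
    using \<gamma> by (simp add: field_simps)
  ultimately show ?thesis
    unfolding v_def[symmetric] e_def[symmetric] by linarith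
qed

lemma norm_add3_square_le:
  fixes a b c :: "'a::real_normed_vector"
  shows "(norm (a + b + c))\<^sup>2 \<le> 3 * ((norm a)\<^sup>2 + (norm b)\<^sup>2 + (norm c)\<^sup>2)"
proof -
  have "norm (a + b + c) \<le> norm a + norm b + norm c"
    by (metis add_right_mono norm_triangle_ineq order_trans)
  then have "(norm (a + b + c))\<^sup>2 \<le> (norm a + norm b + norm c)\<^sup>2"
    by (rule power_mono) simp
  also have "\<dots> \<le> 3 * ((norm a)\<^sup>2 + (norm b)\<^sup>2 + (norm c)\<^sup>2)"
    using zero_le_power2[of "norm a - norm b"] zero_le_power2[of "norm b - norm c"]
      zero_le_power2[of "norm a - norm c"]
    by (simp add: power2_eq_square algebra_simps)
  finally show ?thesis .
qed

text \<open>The displacement \<open>x - q\<close> of the exact proximal step splits into the actual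
  step, the inexactness of \<open>z\<close> and the effect of using \<open>m\<close> for the true
  gradient; the last is controlled by nonexpansiveness of \<open>prox\<close>.\<close>

lemma grad_surrogate_le_inexact_step:
  fixes g h :: "'a::euclidean_space \<Rightarrow> real" and x m z :: 'a and c \<gamma> \<delta> :: real
  defines "F \<equiv> \<lambda>y. g y + 1 / (2 * \<gamma>) * (norm (y - x))\<^sup>2 - c - m \<bullet> (y - x)"
  assumes g: "convex_on UNIV g" and \<gamma>: "\<gamma> > 0"
    and z: "F z - (INF y. F y) \<le> \<gamma> * \<delta>"
  shows "(norm (grad_surrogate \<gamma> g h x))\<^sup>2
    \<le> 3 * (1 / \<gamma>\<^sup>2 * (norm (z - x))\<^sup>2 + 2 * \<delta> + (norm (m - gradient h x))\<^sup>2)"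
proof -
  define p q where "p = prox \<gamma> g (x + \<gamma> *\<^sub>R m)" and "q = prox \<gamma> g (x + \<gamma> *\<^sub>R gradient h x)"
  have "norm (p - q) \<le> norm ((x + \<gamma> *\<^sub>R m) - (x + \<gamma> *\<^sub>R gradient h x))"
    unfolding p_def q_def by (rule prox_nonexpansive[OF g \<gamma>])
  also have "\<dots> = \<gamma> * norm (m - gradient h x)"
    using \<gamma> by (simp flip: scaleR_diff_right)
  finally have "(norm (p - q))\<^sup>2 \<le> (\<gamma> * norm (m - gradient h x))\<^sup>2"
    by (rule power_mono) simp
  moreover have "(norm (z - p))\<^sup>2 \<le> 2 * \<gamma>\<^sup>2 * \<delta>"
    unfolding p_def by (rule inexact_prox_step_near[OF g \<gamma> z[unfolded F_def]])
  moreover have "x - q = (x - z) + (z - p) + (p - q)" by simp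
  ultimately have "(norm (x - q))\<^sup>2
      \<le> 3 * ((norm (z - x))\<^sup>2 + 2 * \<gamma>\<^sup>2 * \<delta> + \<gamma>\<^sup>2 * (norm (m - gradient h x))\<^sup>2)"
    using norm_add3_square_le[of "x - z" "z - p" "p - q"]
    by (simp add: norm_minus_commute[of x z] power_mult_distrib)
  also have "\<dots> = \<gamma>\<^sup>2 * (3 * (1 / \<gamma>\<^sup>2 * (norm (z - x))\<^sup>2 + 2 * \<delta> + (norm (m - gradient h x))\<^sup>2))"
    using \<gamma> by (simp add: distrib_left)
  finally have "(norm (x - q))\<^sup>2 / \<gamma>\<^sup>2 \<le> 3 * (1 / \<gamma>\<^sup>2 * (norm (z - x))\<^sup>2 + 2 * \<delta> + (norm (m - gradient h x))\<^sup>2)"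
    using \<gamma> by (simp add: pos_divide_le_eq mult.commute)
  then show ?thesis
    using \<gamma> by (simp add: grad_surrogate_def q_def power_divide)
qed

text \<open>One of the two factors \<open>1 - \<alpha>\<close> in the square is given up so that the
  drift \<open>u\<close> costs only \<open>1 / \<alpha>\<close>. Later \<open>e\<close> is the old
  momentum error and \<open>u\<close> the change of the gradient between consecutive
  iterates.\<close>

lemma norm_damped_add_square_le:
  fixes e u :: "'a::real_inner"
  assumes "0 < \<alpha>" "\<alpha> \<le> 1"
  shows "(norm ((1 - \<alpha>) *\<^sub>R (e + u)))\<^sup>2 \<le> (1 - \<alpha>) * (norm e)\<^sup>2 + 1 / \<alpha> * (norm u)\<^sup>2"
proof -
  define a b c where "a = e \<bullet> e" and "b = e \<bullet> u" and "c = u \<bullet> u"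
  have expand: "(norm (\<alpha> *\<^sub>R e - (1 - \<alpha>) *\<^sub>R u))\<^sup>2 = \<alpha>\<^sup>2 * a - 2 * \<alpha> * (1 - \<alpha>) * b + (1 - \<alpha>)\<^sup>2 * c"
    unfolding power2_norm_eq_inner a_def b_def c_def
    by (simp add: inner_diff_left inner_diff_right inner_commute[of u e] power2_eq_square algebra_simps)
  have "\<alpha> * (norm ((1 - \<alpha>) *\<^sub>R (e + u)))\<^sup>2 = \<alpha> * (1 - \<alpha>)\<^sup>2 * (a + 2 * b + c)"
    unfolding power2_norm_eq_inner a_def b_def c_def
    by (simp add: inner_add_left inner_add_right inner_commute[of u e] power2_eq_square algebra_simps)
  \<comment> \<open>The subtracted bracket is the squared norm in \<open>expand\<close>, so Young's
    inequality appears as an identity with nonnegative terms taken off.\<close>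
  also have "\<dots> = \<alpha> * (1 - \<alpha>) * a + (1 - \<alpha>) * c
      - (1 - \<alpha>) * (\<alpha>\<^sup>2 * a - 2 * \<alpha> * (1 - \<alpha>) * b + (1 - \<alpha>)\<^sup>2 * c)
      - \<alpha> * (1 - \<alpha>) * c"
    by (simp add: power2_eq_square algebra_simps)
  also have "\<dots> \<le> \<alpha> * (1 - \<alpha>) * a + c"
  proof -
    have "0 \<le> c" by (simp add: c_def)
    moreover have "0 \<le> (1 - \<alpha>) * (\<alpha>\<^sup>2 * a - 2 * \<alpha> * (1 - \<alpha>) * b + (1 - \<alpha>)\<^sup>2 * c)"
      using assms unfolding expand[symmetric] by simp
    moreover have "0 \<le> \<alpha> * (1 - \<alpha>) * c"
      using assms \<open>0 \<le> c\<close> by simp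
    moreover have "(1 - \<alpha>) * c \<le> c"
      using assms \<open>0 \<le> c\<close> by (simp add: mult_left_le_one_le)
    ultimately show ?thesis by linarith
  qed
  also have "\<dots> = \<alpha> * ((1 - \<alpha>) * (norm e)\<^sup>2 + 1 / \<alpha> * (norm u)\<^sup>2)"
    using assms by (simp add: a_def c_def power2_norm_eq_inner distrib_left)
  finally show ?thesis using assms by simp
qed

text \<open>Stated for real sequences: \<open>a\<close>, \<open>b\<close>, \<open>d\<close> will be
  the expectations of the objective gap, the squared error and the squared step. The weights in the
  sum are the surplus after absorption, \<open>5 / 14 - 1 / 3 = 1 / 42\<close> for steps and
  \<open>2 - 7 / 4 = 1 / 4\<close> for errors.\<close>

lemma lyapunov_sum_bound:
  fixes a b d :: "nat \<Rightarrow> real" and L \<gamma> \<delta> v :: real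
  defines "\<alpha> \<equiv> sqrt 6 * L * \<gamma>"
  assumes L: "L > 0" and \<gamma>: "\<gamma> > 0" and \<alpha>: "\<alpha> \<le> 1" and v: "v \<ge> 0"
    and nonneg: "\<And>t. t \<le> T \<Longrightarrow> a t \<ge> 0" "\<And>t. t < T \<Longrightarrow> b t \<ge> 0" "\<And>t. t < T \<Longrightarrow> d t \<ge> 0"
    and descent: "\<And>t. t < T \<Longrightarrow> a (Suc t) + 5 / (14 * \<gamma>) * d t \<le> a t + 7 / 4 * \<gamma> * b t + \<gamma> * \<delta>"
    and error: "\<And>t. Suc t < T \<Longrightarrow> b (Suc t) \<le> (1 - \<alpha>) * b t + L\<^sup>2 / \<alpha> * d t + \<alpha>\<^sup>2 * v"
    and T: "T \<ge> 1"
  shows "(\<Sum>t<T. 1 / (42 * \<gamma>) * d t + \<gamma> / 4 * b t)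
    \<le> a 0 + 2 / (sqrt 6 * L) * b 0 + T * (\<gamma> * \<delta> + 2 * sqrt 6 * L * \<gamma>\<^sup>2 * v)"
proof -
  define c where "c = 2 / (sqrt 6 * L)"
  \<comment> \<open>No sample is drawn at time \<open>T\<close>, so the error sequence is continued by \<open>0\<close>.\<close>
  define b' where "b' = (\<lambda>t. if t < T then b t else 0)"
  have \<alpha>0: "\<alpha> > 0" using L \<gamma> by (simp add: \<alpha>_def)
  have c0: "c > 0" using L by (simp add: c_def)
  have ca: "c * \<alpha> = 2 * \<gamma>" using L by (simp add: c_def \<alpha>_def field_simps)
  have s6: "sqrt 6 * sqrt 6 = (6::real)" by simp
  have cL: "c * (L\<^sup>2 / \<alpha>) = 1 / (3 * \<gamma>)"
  proof -
    have "c * (L\<^sup>2 / \<alpha>) = 2 / (sqrt 6 * sqrt 6 * \<gamma>)"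
      using L \<gamma> by (simp add: c_def \<alpha>_def field_simps power2_eq_square del: real_sqrt_mult_self)
    then show ?thesis by (simp add: s6 field_simps)
  qed
  have cv: "c * \<alpha>\<^sup>2 = 2 * sqrt 6 * L * \<gamma>\<^sup>2"
  proof -
    have "c * \<alpha>\<^sup>2 = (c * \<alpha>) * \<alpha>" by (simp add: power2_eq_square)
    also have "\<dots> = 2 * sqrt 6 * L * \<gamma>\<^sup>2" unfolding ca by (simp add: \<alpha>_def power2_eq_square)
    finally show ?thesis .
  qed
  have error': "b' (Suc t) \<le> (1 - \<alpha>) * b' t + L\<^sup>2 / \<alpha> * d t + \<alpha>\<^sup>2 * v" if "t < T" for t
  proof (cases "Suc t < T")
    case True
    then show ?thesis using error by (simp add: b'_def)
  next
    case False
    have "0 \<le> (1 - \<alpha>) * b t + L\<^sup>2 / \<alpha> * d t + \<alpha>\<^sup>2 * v"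
      using that nonneg \<alpha> \<alpha>0 v by (intro add_nonneg_nonneg mult_nonneg_nonneg) auto
    then show ?thesis using that False by (simp add: b'_def)
  qed
  have "a n + c * b' n + (\<Sum>t<n. 1 / (42 * \<gamma>) * d t + \<gamma> / 4 * b t)
      \<le> a 0 + c * b' 0 + n * (\<gamma> * \<delta> + 2 * sqrt 6 * L * \<gamma>\<^sup>2 * v)" if "n \<le> T" for n
    using that
  proof (induction n)
    case 0
    then show ?case by simp
  next
    case (Suc n)
    have "c * b' (Suc n) \<le> c * ((1 - \<alpha>) * b' n + L\<^sup>2 / \<alpha> * d n + \<alpha>\<^sup>2 * v)"
      using error'[of n] Suc.prems c0 by (intro mult_left_mono) auto
    also have "\<dots> = c * b' n - (c * \<alpha>) * b' n + c * (L\<^sup>2 / \<alpha>) * d n + (c * \<alpha>\<^sup>2) * v"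
      by (simp add: algebra_simps)
    also have "\<dots> = c * b' n - 2 * \<gamma> * b n + 1 / (3 * \<gamma>) * d n + 2 * sqrt 6 * L * \<gamma>\<^sup>2 * v"
      unfolding ca cL cv using Suc.prems by (simp add: b'_def)
    finally have 1: "c * b' (Suc n) \<le> \<dots>" .
    have 2: "5 / (14 * \<gamma>) * d n = 1 / (3 * \<gamma>) * d n + 1 / (42 * \<gamma>) * d n"
      using \<gamma> by (simp add: field_simps)
    have 3: "2 * \<gamma> * b n = 7 / 4 * \<gamma> * b n + \<gamma> / 4 * b n"
      by simp
    have 4: "real (Suc n) * (\<gamma> * \<delta> + 2 * sqrt 6 * L * \<gamma>\<^sup>2 * v)
        = real n * (\<gamma> * \<delta> + 2 * sqrt 6 * L * \<gamma>\<^sup>2 * v) + (\<gamma> * \<delta> + 2 * sqrt 6 * L * \<gamma>\<^sup>2 * v)"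
      by (simp add: algebra_simps)
    have "a (Suc n) + 5 / (14 * \<gamma>) * d n \<le> a n + 7 / 4 * \<gamma> * b n + \<gamma> * \<delta>"
      using Suc.prems by (intro descent) simp
    with 1 2 3 4 Suc show ?case
      unfolding sum.lessThan_Suc by linarith
  qed
  from this[of T] nonneg(1)[of T] T show ?thesis
    by (simp add: b'_def c_def[symmetric])
qed

text \<open>The step size balances the initial and the noise term. Lying below the second entry of
  the minimum bounds the noise by \<open>r\<close> (for \<open>\<sigma> = 0\<close> the noise
  vanishes), and equality with one of the entries bounds \<open>\<phi> / (\<gamma> * T)\<close> by
  the sum of both rates.\<close>

lemma step_size_rate:
  fixes L \<gamma> \<delta> \<sigma> \<phi> :: real and T :: nat
  assumes L: "L > 0" and T: "T \<ge> 1" and \<delta>: "\<delta> \<ge> 0" and \<phi>: "\<phi> > 0"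
    and \<gamma>: "\<gamma> = (if \<sigma> = 0 then 1 / (sqrt 6 * L)
              else min (1 / (sqrt 6 * L)) (sqrt (\<phi> / (L * \<sigma>\<^sup>2 * real T))))"
  shows "126 / (\<gamma> * T) * (\<phi> + T * (\<gamma> * \<delta> + 2 * sqrt 6 * L * \<gamma>\<^sup>2 * \<sigma>\<^sup>2)) + 6 * \<delta>
    \<le> 1000 * (sqrt (L * \<sigma>\<^sup>2 * \<phi> / T) + L * \<phi> / T + \<delta>)"
proof -
  define r where "r = sqrt (L * \<sigma>\<^sup>2 * \<phi> / T)"
  have T0: "real T > 0" using T by simp
  have r0: "r \<ge> 0" using L \<phi> by (simp add: r_def)
  have s: "sqrt 6 \<le> (5/2::real)" by (rule real_le_lsqrt) (simp_all add: power2_eq_square)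
  have \<gamma>0: "\<gamma> > 0" using L \<phi> T0 by (simp add: \<gamma>)
  have noise: "L * \<gamma> * \<sigma>\<^sup>2 \<le> r"
  proof (cases "\<sigma> = 0")
    case False
    have "\<gamma> \<le> sqrt (\<phi> / (L * \<sigma>\<^sup>2 * real T))" using False by (simp add: \<gamma>)
    then have "(L * \<sigma>\<^sup>2) * \<gamma> \<le> (L * \<sigma>\<^sup>2) * sqrt (\<phi> / (L * \<sigma>\<^sup>2 * real T))"
      using L by (intro mult_left_mono) auto
    also have "\<dots> = sqrt ((L * \<sigma>\<^sup>2)\<^sup>2 * (\<phi> / (L * \<sigma>\<^sup>2 * real T)))"
      using L by (subst real_sqrt_mult) simp
    also have "(L * \<sigma>\<^sup>2)\<^sup>2 * (\<phi> / (L * \<sigma>\<^sup>2 * real T)) = L * \<sigma>\<^sup>2 * \<phi> / T"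
      using L False T0 by (simp add: power2_eq_square field_simps)
    finally show ?thesis by (simp add: r_def mult_ac)
  qed (use r0 in simp)
  have init: "\<phi> / (\<gamma> * T) \<le> sqrt 6 * (L * \<phi> / T) + r"
  proof -
    have 1: "0 \<le> sqrt 6 * (L * \<phi> / T)" using L \<phi> by simp
    consider "\<gamma> = 1 / (sqrt 6 * L)" | "\<sigma> \<noteq> 0" "\<gamma> = sqrt (\<phi> / (L * \<sigma>\<^sup>2 * real T))"
      unfolding \<gamma> min_def by presburger
    then show ?thesis
    proof cases
      case 1
      then have "\<phi> / (\<gamma> * T) = sqrt 6 * (L * \<phi> / T)" using L by simp
      then show ?thesis using r0 by simp
    next
      case 2
      have "r * \<gamma> = sqrt (L * \<sigma>\<^sup>2 * \<phi> / T * (\<phi> / (L * \<sigma>\<^sup>2 * real T)))"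
        unfolding 2(2) r_def by (rule real_sqrt_mult[symmetric])
      also have "L * \<sigma>\<^sup>2 * \<phi> / T * (\<phi> / (L * \<sigma>\<^sup>2 * real T)) = (\<phi> / T)\<^sup>2"
        using L 2 T0 by (simp add: power2_eq_square field_simps)
      also have "sqrt ((\<phi> / T)\<^sup>2) = \<phi> / T" using \<phi> by simp
      finally have "\<phi> / (\<gamma> * T) = r" using \<gamma>0 T0 by (simp add: field_simps)
      then show ?thesis using 1 by simp
    qed
  qed
  have "126 / (\<gamma> * T) * (\<phi> + T * (\<gamma> * \<delta> + 2 * sqrt 6 * L * \<gamma>\<^sup>2 * \<sigma>\<^sup>2)) + 6 * \<delta>
      = 126 * (\<phi> / (\<gamma> * T)) + 132 * \<delta> + 252 * (sqrt 6 * (L * \<gamma> * \<sigma>\<^sup>2))"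
    using \<gamma>0 T0 by (simp add: field_simps power2_eq_square)
  \<comment> \<open>With \<open>sqrt 6 \<le> 5 / 2\<close> the coefficients come to 756 for
    \<open>r\<close>, 315 for \<open>q\<close> and 132 for \<open>\<delta>\<close>.\<close>
  also have "\<dots> \<le> 1000 * (r + L * \<phi> / T + \<delta>)"
  proof -
    define q where "q = L * \<phi> / T"
    have "q \<ge> 0" using L \<phi> by (simp add: q_def)
    then have "sqrt 6 * q \<le> 5/2 * q"
      using s by (intro mult_right_mono) auto
    then have "\<phi> / (\<gamma> * T) \<le> 5/2 * q + r"
      using init unfolding q_def[symmetric] by linarith
    moreover have "sqrt 6 * (L * \<gamma> * \<sigma>\<^sup>2) \<le> 5/2 * r"
      using s noise r0 L \<gamma>0 by (intro mult_mono) auto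
    moreover have "126 * u + 132 * \<delta> + 252 * w \<le> 1000 * (r + q + \<delta>)"
      if "u \<le> 5/2 * q + r" and "w \<le> 5/2 * r" for u w
      using that r0 \<delta> \<open>q \<ge> 0\<close> by simp
    ultimately show ?thesis unfolding q_def[symmetric] by blast
  qed
  finally show ?thesis by (simp add: r_def)
qed

section \<open>The convergence rate\<close>

theorem mainTheorem4:
  fixes g h :: "'a::euclidean_space \<Rightarrow> real"
    and H :: "'a \<Rightarrow> 's \<Rightarrow> real"
    and M :: "'w measure" and D :: "'s measure"
    and X :: "nat \<Rightarrow> 'w \<Rightarrow> 'a" and \<xi> :: "nat \<Rightarrow> 'w \<Rightarrow> 's"
    and L \<sigma> \<gamma> \<delta> fstar \<phi>0 :: real and T :: nat
  assumes "prob_space M" and "prob_space D"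
    and "convex_on UNIV g" and "convex_on UNIV h"
    and "bdd_below (range (\<lambda>x. g x - h x))"
    and "fstar = (INF x. g x - h x)"
    and "L > 0" and "smooth_with L h"
    and "(\<lambda>(x, s). H x s) \<in> borel_measurable (borel \<Otimes>\<^sub>M D)"
    and "\<And>x s. s \<in> space D \<Longrightarrow> (\<lambda>y. H y s) differentiable (at x)"
    and "\<And>x. integrable D (H x)" and "\<And>x. (\<integral>s. H x s \<partial>D) = h x"
    and "\<And>x. integrable D (stoch_grad H x)"
    and "\<And>x. (\<integral>s. stoch_grad H x s \<partial>D) = gradient h x"
    and "\<And>x. integrable D (\<lambda>s. (norm (stoch_grad H x s - gradient h x))\<^sup>2)"
    and "\<And>x. (\<integral>s. (norm (stoch_grad H x s - gradient h x))\<^sup>2 \<partial>D) \<le> \<sigma>\<^sup>2"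
    and "T \<ge> 1" and "\<delta> \<ge> 0"
    and "stoch_prox_dc_run M D g H (\<lambda>_. \<gamma>) (\<lambda>_. sqrt 6 * L * \<gamma>) (\<lambda>_. \<delta>) T X \<xi>"
    and "integrable M (\<lambda>\<omega>. g (X 0 \<omega>) - h (X 0 \<omega>) - fstar)"
    and "integrable M (\<lambda>\<omega>. (norm (stoch_grad H (X 0 \<omega>) (\<xi> 0 \<omega>) - gradient h (X 0 \<omega>)))\<^sup>2)"
    and "\<And>t. t < T \<Longrightarrow> integrable M (\<lambda>\<omega>. (norm (grad_surrogate \<gamma> g h (X t \<omega>)))\<^sup>2)"
    and "\<phi>0 = (\<integral>\<omega>. g (X 0 \<omega>) - h (X 0 \<omega>) - fstar \<partial>M)
           + 2 / (sqrt 6 * L) *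
             (\<integral>\<omega>. (norm (stoch_grad H (X 0 \<omega>) (\<xi> 0 \<omega>) - gradient h (X 0 \<omega>)))\<^sup>2 \<partial>M)"
    and "\<phi>0 > 0"
    and "\<gamma> = (if \<sigma> = 0 then 1 / (sqrt 6 * L)
              else min (1 / (sqrt 6 * L)) (sqrt (\<phi>0 / (L * \<sigma>\<^sup>2 * real T))))"
  shows "1 / real T * (\<Sum>t<T. \<integral>\<omega>. (norm (grad_surrogate \<gamma> g h (X t \<omega>)))\<^sup>2 \<partial>M)
         \<le> dc_rate_const * (sqrt (L * \<sigma>\<^sup>2 * \<phi>0 / real T) + L * \<phi>0 / real T + \<delta>)"
proof -
  define \<alpha> where "\<alpha> = sqrt 6 * L * \<gamma>"
  define e where "e = (\<lambda>t \<omega>. momentum H (\<lambda>_. \<alpha>) (\<lambda>i. X i \<omega>) (\<lambda>i. \<xi> i \<omega>) t - gradient h (X t \<omega>))"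
  define p where "p = (\<lambda>t \<omega>. g (X t \<omega>) - h (X t \<omega>) - fstar)"
  define d where "d = (\<lambda>t \<omega>. (norm (X (Suc t) \<omega> - X t \<omega>))\<^sup>2)"
  interpret prob_space M by (rule assms(1))
  interpret D: prob_space D by (rule assms(2))
  note cvx = assms(3,4) and L = \<open>L > 0\<close>
  have T0: "real T > 0" using \<open>T \<ge> 1\<close> by simp
  have \<gamma>: "\<gamma> > 0"
    using L \<open>\<phi>0 > 0\<close> T0 unfolding assms(25) by simp
  have "\<gamma> \<le> 1 / (sqrt 6 * L)" unfolding assms(25) by simp
  then have "(sqrt 6 * L) * \<gamma> \<le> (sqrt 6 * L) * (1 / (sqrt 6 * L))"
    using L by (intro mult_left_mono) auto
  then have \<alpha>: "0 < \<alpha>" "\<alpha> \<le> 1" using L \<gamma> by (simp_all add: \<alpha>_def)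

  \<comment> \<open>Regularity of \<open>g\<close> and \<open>h\<close>, and the facts contained in
    a run\<close>
  have h_diff: "h differentiable (at x)" and lip: "L-lipschitz_on UNIV (gradient h)" for x
    using \<open>smooth_with L h\<close> by (auto simp: smooth_with_def)
  have [measurable]: "g \<in> borel_measurable borel" "h \<in> borel_measurable borel"
    using cvx by (auto intro!: borel_measurable_continuous_onI convex_on_continuous)
  have [measurable]: "gradient h \<in> borel_measurable borel"
    using lipschitz_on_continuous_on[OF lip] by (rule borel_measurable_continuous_onI)
  have sg: "(\<lambda>(x, s). stoch_grad H x s) \<in> borel_measurable (borel \<Otimes>\<^sub>M D)"
    using assms(9,10) by (rule borel_measurable_stoch_grad)

  have X [measurable]: "X t \<in> borel_measurable M" if "t \<le> T" for t
    using assms(19) that unfolding stoch_prox_dc_run_def by blast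
  have \<xi>: "\<xi> t \<in> measurable M D" "distr M D (\<xi> t) = D"
      "indep_set {\<xi> t -` A \<inter> space M | A. A \<in> sets D} (past_events M D X \<xi> t)" if "t < T" for t
    using assms(19) that unfolding stoch_prox_dc_run_def by blast+
  have step: "(let F = (\<lambda>y. g y + 1 / (2 * \<gamma>) * (norm (y - X t \<omega>))\<^sup>2 - H (X t \<omega>) (\<xi> t \<omega>)
        - momentum H (\<lambda>_. \<alpha>) (\<lambda>i. X i \<omega>) (\<lambda>i. \<xi> i \<omega>) t \<bullet> (y - X t \<omega>))
      in F (X (Suc t) \<omega>) - (INF y. F y) \<le> \<gamma> * \<delta>)" if "t < T" "\<omega> \<in> space M" for t \<omega>
    using assms(19) that unfolding stoch_prox_dc_run_def subproblem_def \<alpha>_def by blast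

  \<comment> \<open>Pathwise one-step inequalities\<close>
  have p_nonneg: "p t \<omega> \<ge> 0" for t \<omega>
    using cINF_lower[OF assms(5), of "X t \<omega>"] by (simp add: p_def assms(6))
  have descent: "p (Suc t) \<omega> + 5 / (14 * \<gamma>) * d t \<omega> \<le> p t \<omega> + 7 / 4 * \<gamma> * (norm (e t \<omega>))\<^sup>2 + \<gamma> * \<delta>"
    if "t < T" "\<omega> \<in> space M" for t \<omega>
    using inexact_prox_step_descent[OF cvx(1) \<gamma> cvx(2) h_diff step[OF that, unfolded Let_def]]
    by (simp add: p_def d_def e_def)
  have surrogate: "(norm (grad_surrogate \<gamma> g h (X t \<omega>)))\<^sup>2 \<le> 3 * (1 / \<gamma>\<^sup>2 * d t \<omega> + 2 * \<delta> + (norm (e t \<omega>))\<^sup>2)"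
    if "t < T" "\<omega> \<in> space M" for t \<omega>
    using grad_surrogate_le_inexact_step[OF cvx(1) \<gamma> step[OF that, unfolded Let_def], of h]
    by (simp add: d_def e_def)

  \<comment> \<open>Measurability along the run\<close>
  have e_meas: "e t \<in> borel_measurable M" if "t < T" for t
    unfolding e_def using that X \<xi>(1)
    by (intro borel_measurable_diff borel_measurable_momentum[OF sg]
        measurable_compose[OF X \<open>gradient h \<in> borel_measurable borel\<close>]) auto
  have d_meas: "d t \<in> borel_measurable M" if "t < T" for t
    unfolding d_def using that by (intro borel_measurable_power borel_measurable_norm borel_measurable_diff X) auto
  \<comment> \<open>The gap is needed up to time \<open>T\<close> inclusive: the last iterate
    exists, but the run draws no sample there, so the error stops at \<open>t < T\<close>.\<close>
  have p_meas: "p t \<in> borel_measurable M" if "t \<le> T" for t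
    unfolding p_def using X[OF that] by measurable

  \<comment> \<open>Gap and error are assumed integrable only at time 0 and have to be propagated.
    Both terms on the left of \<open>descent\<close> are nonnegative, so each is dominated by the
    right-hand side; integrability of the step then feeds the error recursion.\<close>
  have descent_integrable: "integrable M (p (Suc t))" "integrable M (d t)"
    if t: "t < T" and int: "integrable M (p t)" "integrable M (\<lambda>\<omega>. (norm (e t \<omega>))\<^sup>2)" for t
  proof -
    have R: "integrable M (\<lambda>\<omega>. p t \<omega> + 7 / 4 * \<gamma> * (norm (e t \<omega>))\<^sup>2 + \<gamma> * \<delta>)"
      using int by simp
    have d0: "5 / (14 * \<gamma>) * d t \<omega> \<ge> 0" for \<omega> using \<gamma> by (simp add: d_def)
    show "integrable M (p (Suc t))"
    proof (rule Bochner_Integration.integrable_bound[OF R p_meas])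
      show "AE \<omega> in M. norm (p (Suc t) \<omega>) \<le> norm (p t \<omega> + 7 / 4 * \<gamma> * (norm (e t \<omega>))\<^sup>2 + \<gamma> * \<delta>)"
        using descent[OF t] d0 p_nonneg by (intro AE_I2) (smt (verit) real_norm_def)
    qed (use t in simp)
    have "integrable M (\<lambda>\<omega>. 5 / (14 * \<gamma>) * d t \<omega>)"
    proof (rule Bochner_Integration.integrable_bound[OF R])
      show "AE \<omega> in M. norm (5 / (14 * \<gamma>) * d t \<omega>) \<le> norm (p t \<omega> + 7 / 4 * \<gamma> * (norm (e t \<omega>))\<^sup>2 + \<gamma> * \<delta>)"
        using descent[OF t] d0 p_nonneg by (intro AE_I2) (smt (verit) real_norm_def)
    qed (use d_meas[OF t] in measurable)
    from integrable_mult_right[OF this, of "14 * \<gamma> / 5"] show "integrable M (d t)"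
      using \<gamma> by simp
  qed

  \<comment> \<open>Recursion for the mean squared momentum error\<close>
  have error: "integrable M (\<lambda>\<omega>. (norm (e (Suc t) \<omega>))\<^sup>2)" (is ?int)
      "(\<integral>\<omega>. (norm (e (Suc t) \<omega>))\<^sup>2 \<partial>M)
        \<le> (1 - \<alpha>) * (\<integral>\<omega>. (norm (e t \<omega>))\<^sup>2 \<partial>M) + L\<^sup>2 / \<alpha> * (\<integral>\<omega>. d t \<omega> \<partial>M) + \<alpha>\<^sup>2 * \<sigma>\<^sup>2" (is ?le)
    if t: "Suc t < T" and int: "integrable M (\<lambda>\<omega>. (norm (e t \<omega>))\<^sup>2)" "integrable M (d t)" for t
  proof -
    \<comment> \<open>This sigma-algebra is generated by the iterates up to \<open>X (Suc t)\<close>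
      and the samples up to \<open>\<xi> t\<close>. It therefore determines the momentum at time
      \<open>t\<close> and the new iterate, while \<open>\<xi> (Suc t)\<close> is independent of
      it.\<close>
    define F where "F = sigma (space M) (past_events M D X \<xi> (Suc t))"
    have gen: "{X i -` A \<inter> space M | i A. i \<le> Suc t \<and> A \<in> sets borel} \<union>
      {\<xi> i -` A \<inter> space M | i A. i < Suc t \<and> A \<in> sets D} \<subseteq> Pow (space M)" by auto
    have spF: "space F = space M" by (simp add: F_def space_measure_of_conv)
    have setsF: "sets F = past_events M D X \<xi> (Suc t)"
      unfolding F_def past_events_def
      by (subst sets_measure_of) (auto intro!: sigma_sets_sigma_sets_eq dest: sigma_sets_into_sp[OF gen])
    have XF [measurable]: "X i \<in> borel_measurable F" if "i \<le> Suc t" for i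
      using that by (intro measurableI) (auto simp: spF setsF past_events_def intro!: sigma_sets.Basic)
    have \<xi>F: "\<xi> i \<in> measurable F D" if "i < Suc t" for i
      using that t measurable_space[OF \<xi>(1), of i]
      by (intro measurableI) (auto simp: spF setsF past_events_def intro!: sigma_sets.Basic)
    define m where "m = (\<lambda>\<omega>. momentum H (\<lambda>_. \<alpha>) (\<lambda>i. X i \<omega>) (\<lambda>i. \<xi> i \<omega>) t)"
    \<comment> \<open>The new error is \<open>A\<close>, determined by the past, plus
      \<open>\<alpha>\<close> times the fresh noise \<open>n\<close>; \<open>A\<close> measures the
      old momentum against the gradient at the new iterate.\<close>
    define A where "A = (\<lambda>\<omega>. (1 - \<alpha>) *\<^sub>R (m \<omega> - gradient h (X (Suc t) \<omega>)))"
    define n where "n = (\<lambda>x s. stoch_grad H x s - gradient h x)"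
    define k where "k = (\<lambda>z. ennreal ((norm (A (fst z) + \<alpha> *\<^sub>R n (X (Suc t) (fst z)) (snd z)))\<^sup>2))"
    have mF [measurable]: "m \<in> borel_measurable F"
      unfolding m_def using XF \<xi>F by (intro borel_measurable_momentum[OF sg]) auto
    have AF [measurable]: "A \<in> borel_measurable F"
      unfolding A_def using XF[of "Suc t"] by measurable
    have XF' [measurable]: "X (Suc t) \<in> borel_measurable F" by (rule XF) simp
    have "(\<lambda>z. stoch_grad H (X (Suc t) (fst z)) (snd z)) \<in> borel_measurable (F \<Otimes>\<^sub>M D)"
    proof -
      have "(\<lambda>z. (X (Suc t) (fst z), snd z)) \<in> measurable (F \<Otimes>\<^sub>M D) (borel \<Otimes>\<^sub>M D)"
        by measurable
      from measurable_compose[OF this sg] show ?thesis by simp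
    qed
    then have k: "k \<in> borel_measurable (F \<Otimes>\<^sub>M D)"
      unfolding k_def n_def by measurable
    have e_Suc: "e (Suc t) \<omega> = A \<omega> + \<alpha> *\<^sub>R n (X (Suc t) \<omega>) (\<xi> (Suc t) \<omega>)" for \<omega>
      by (simp add: e_def A_def n_def m_def algebra_simps)
    have A_le: "(norm (A \<omega>))\<^sup>2 \<le> (1 - \<alpha>) * (norm (e t \<omega>))\<^sup>2 + L\<^sup>2 / \<alpha> * d t \<omega>" for \<omega>
    proof -
      \<comment> \<open>The drift of the true gradient, controlled by the step through the Lipschitz
        bound.\<close>
      define u where "u = gradient h (X t \<omega>) - gradient h (X (Suc t) \<omega>)"
      have "A \<omega> = (1 - \<alpha>) *\<^sub>R (e t \<omega> + u)"
        by (simp add: A_def e_def m_def u_def)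
      then have "(norm (A \<omega>))\<^sup>2 \<le> (1 - \<alpha>) * (norm (e t \<omega>))\<^sup>2 + 1 / \<alpha> * (norm u)\<^sup>2"
        using norm_damped_add_square_le[OF \<alpha>] by simp
      moreover have "norm u \<le> L * norm (X (Suc t) \<omega> - X t \<omega>)"
        using lipschitz_onD[OF lip, of "X t \<omega>" "X (Suc t) \<omega>"]
        by (simp add: u_def dist_norm norm_minus_commute)
      then have "(norm u)\<^sup>2 \<le> L\<^sup>2 * d t \<omega>"
        unfolding d_def power_mult_distrib[symmetric] by (rule power_mono) simp
      then have "1 / \<alpha> * (norm u)\<^sup>2 \<le> 1 / \<alpha> * (L\<^sup>2 * d t \<omega>)"
        using \<alpha> by (intro mult_left_mono) auto
      ultimately show ?thesis by simp
    qed
    define R where "R = (\<lambda>\<omega>. (1 - \<alpha>) * (norm (e t \<omega>))\<^sup>2 + L\<^sup>2 / \<alpha> * d t \<omega> + \<alpha>\<^sup>2 * \<sigma>\<^sup>2)"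
    have R: "integrable M R" unfolding R_def using int by simp
    have R0: "R \<omega> \<ge> 0" for \<omega>
      using \<alpha> by (simp add: R_def d_def)
    have noise: "(\<integral>\<^sup>+ s. k (\<omega>, s) \<partial>D) \<le> ennreal (R \<omega>)" for \<omega>
    proof -
      have "(\<integral>\<^sup>+ s. k (\<omega>, s) \<partial>D) \<le> ennreal ((norm (A \<omega>))\<^sup>2 + \<alpha>\<^sup>2 * \<sigma>\<^sup>2)"
        unfolding k_def fst_conv snd_conv using assms(13-16)
        by (intro D.nn_integral_norm_add_centered) (simp_all add: n_def D.prob_space)
      also have "\<dots> \<le> ennreal (R \<omega>)"
        using A_le[of \<omega>] by (intro ennreal_leI) (simp add: R_def)
      finally show ?thesis .
    qed
    \<comment> \<open>The new error is not yet known to be integrable; with nonnegative integrals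
      one chain of inequalities yields both its integrability and the bound.\<close>
    have "(\<integral>\<^sup>+ \<omega>. ennreal ((norm (e (Suc t) \<omega>))\<^sup>2) \<partial>M) = (\<integral>\<^sup>+ \<omega>. k (\<omega>, \<xi> (Suc t) \<omega>) \<partial>M)"
      by (simp add: k_def e_Suc)
    also have "\<dots> = (\<integral>\<^sup>+ \<omega>. \<integral>\<^sup>+ s. k (\<omega>, s) \<partial>D \<partial>M)"
      using \<xi>[OF t] k by (intro nn_integral_independent_pair[where F = F] spF) (simp_all add: setsF assms(2))
    also have "\<dots> \<le> (\<integral>\<^sup>+ \<omega>. ennreal (R \<omega>) \<partial>M)"
      by (intro nn_integral_mono noise)
    also have "\<dots> = ennreal (\<integral>\<omega>. R \<omega> \<partial>M)"
      using R R0 by (intro nn_integral_eq_integral) auto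
    finally have bound: "(\<integral>\<^sup>+ \<omega>. ennreal ((norm (e (Suc t) \<omega>))\<^sup>2) \<partial>M) \<le> ennreal (\<integral>\<omega>. R \<omega> \<partial>M)" .
    show ?int
    proof (rule integrableI_nonneg)
      show "(\<lambda>\<omega>. (norm (e (Suc t) \<omega>))\<^sup>2) \<in> borel_measurable M"
        using e_meas[OF t] by measurable
      show "(\<integral>\<^sup>+ \<omega>. ennreal ((norm (e (Suc t) \<omega>))\<^sup>2) \<partial>M) < \<infinity>"
        using bound by (rule order_le_less_trans) simp
    qed simp
    then have "ennreal (\<integral>\<omega>. (norm (e (Suc t) \<omega>))\<^sup>2 \<partial>M) \<le> ennreal (\<integral>\<omega>. R \<omega> \<partial>M)"
      using bound by (subst (asm) nn_integral_eq_integral) auto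
    then have "(\<integral>\<omega>. (norm (e (Suc t) \<omega>))\<^sup>2 \<partial>M) \<le> (\<integral>\<omega>. R \<omega> \<partial>M)"
      using R0 by (subst (asm) ennreal_le_iff) (auto intro: Bochner_Integration.integral_nonneg)
    also have "\<dots> = (1 - \<alpha>) * (\<integral>\<omega>. (norm (e t \<omega>))\<^sup>2 \<partial>M) + L\<^sup>2 / \<alpha> * (\<integral>\<omega>. d t \<omega> \<partial>M) + \<alpha>\<^sup>2 * \<sigma>\<^sup>2"
      unfolding R_def using int by (simp add: prob_space)
    finally show ?le .
  qed

  \<comment> \<open>Integrability at all times\<close>
  have int: "integrable M (p t) \<and> integrable M (\<lambda>\<omega>. (norm (e t \<omega>))\<^sup>2)" if "t < T" for t
    using that
  proof (induction t)
    case 0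
    then show ?case using assms(20,21) by (simp add: p_def e_def)
  next
    case (Suc t)
    then show ?case using descent_integrable error(1) by simp
  qed
  have int_d: "integrable M (d t)" and int_p: "integrable M (p (Suc t))" if "t < T" for t
    using descent_integrable[OF that] int[OF that] by auto

  \<comment> \<open>The Lyapunov inequality for expectations\<close>
  have "(\<Sum>t<T. 1 / (42 * \<gamma>) * (\<integral>\<omega>. d t \<omega> \<partial>M) + \<gamma> / 4 * (\<integral>\<omega>. (norm (e t \<omega>))\<^sup>2 \<partial>M))
      \<le> (\<integral>\<omega>. p 0 \<omega> \<partial>M) + 2 / (sqrt 6 * L) * (\<integral>\<omega>. (norm (e 0 \<omega>))\<^sup>2 \<partial>M)
        + T * (\<gamma> * \<delta> + 2 * sqrt 6 * L * \<gamma>\<^sup>2 * \<sigma>\<^sup>2)"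
  proof (rule lyapunov_sum_bound[OF L \<gamma> \<alpha>(2)[unfolded \<alpha>_def] _ _ _ _ _ _ \<open>T \<ge> 1\<close>])
    fix t assume t: "t < T"
    have "(\<integral>\<omega>. p (Suc t) \<omega> + 5 / (14 * \<gamma>) * d t \<omega> \<partial>M)
        \<le> (\<integral>\<omega>. p t \<omega> + 7 / 4 * \<gamma> * (norm (e t \<omega>))\<^sup>2 + \<gamma> * \<delta> \<partial>M)"
      using int[OF t] int_d[OF t] int_p[OF t] descent[OF t] by (intro integral_mono) auto
    then show "(\<integral>\<omega>. p (Suc t) \<omega> \<partial>M) + 5 / (14 * \<gamma>) * (\<integral>\<omega>. d t \<omega> \<partial>M)
        \<le> (\<integral>\<omega>. p t \<omega> \<partial>M) + 7 / 4 * \<gamma> * (\<integral>\<omega>. (norm (e t \<omega>))\<^sup>2 \<partial>M) + \<gamma> * \<delta>"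
      using int[OF t] int_d[OF t] int_p[OF t] by (simp add: prob_space)
  next
    fix t assume t: "Suc t < T"
    show "(\<integral>\<omega>. (norm (e (Suc t) \<omega>))\<^sup>2 \<partial>M)
        \<le> (1 - sqrt 6 * L * \<gamma>) * (\<integral>\<omega>. (norm (e t \<omega>))\<^sup>2 \<partial>M)
          + L\<^sup>2 / (sqrt 6 * L * \<gamma>) * (\<integral>\<omega>. d t \<omega> \<partial>M) + (sqrt 6 * L * \<gamma>)\<^sup>2 * \<sigma>\<^sup>2"
      using t int[of t] int_d[of t] unfolding \<alpha>_def[symmetric] by (intro error(2)) auto
  qed (auto intro!: Bochner_Integration.integral_nonneg p_nonneg simp: d_def)
  then have lyapunov: "(\<Sum>t<T. 1 / (42 * \<gamma>) * (\<integral>\<omega>. d t \<omega> \<partial>M) + \<gamma> / 4 * (\<integral>\<omega>. (norm (e t \<omega>))\<^sup>2 \<partial>M))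
      \<le> \<phi>0 + T * (\<gamma> * \<delta> + 2 * sqrt 6 * L * \<gamma>\<^sup>2 * \<sigma>\<^sup>2)" (is "?S \<le> ?B")
    by (simp add: assms(23) p_def e_def)

  \<comment> \<open>From the Lyapunov bound to the averaged surrogate\<close>
  have "(\<integral>\<omega>. (norm (grad_surrogate \<gamma> g h (X t \<omega>)))\<^sup>2 \<partial>M)
      \<le> 126 / \<gamma> * (1 / (42 * \<gamma>) * (\<integral>\<omega>. d t \<omega> \<partial>M) + \<gamma> / 4 * (\<integral>\<omega>. (norm (e t \<omega>))\<^sup>2 \<partial>M)) + 6 * \<delta>"
    if t: "t < T" for t
  proof -
    have "(\<integral>\<omega>. (norm (grad_surrogate \<gamma> g h (X t \<omega>)))\<^sup>2 \<partial>M)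
        \<le> (\<integral>\<omega>. 3 * (1 / \<gamma>\<^sup>2 * d t \<omega> + 2 * \<delta> + (norm (e t \<omega>))\<^sup>2) \<partial>M)"
      using int[OF t] int_d[OF t] surrogate[OF t] assms(22)[OF t] by (intro integral_mono) auto
    also have "\<dots> = 3 * (1 / \<gamma>\<^sup>2 * (\<integral>\<omega>. d t \<omega> \<partial>M) + 2 * \<delta> + (\<integral>\<omega>. (norm (e t \<omega>))\<^sup>2 \<partial>M))"
      using int[OF t] int_d[OF t] by (simp add: prob_space)
    \<comment> \<open>The error coefficient 3 is enlarged to fit the Lyapunov weights: the common
      factor \<open>126 / \<gamma>\<close> turns \<open>1 / (42 * \<gamma>)\<close> into
      \<open>3 / \<gamma>\<^sup>2\<close> and \<open>\<gamma> / 4\<close> into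
      \<open>63 / 2\<close>.\<close>
    also have "\<dots> \<le> 3 / \<gamma>\<^sup>2 * (\<integral>\<omega>. d t \<omega> \<partial>M) + 63 / 2 * (\<integral>\<omega>. (norm (e t \<omega>))\<^sup>2 \<partial>M) + 6 * \<delta>"
    proof -
      have "(\<integral>\<omega>. (norm (e t \<omega>))\<^sup>2 \<partial>M) \<ge> 0" by simp
      then show ?thesis by simp
    qed
    also have "\<dots> = 126 / \<gamma> * (1 / (42 * \<gamma>) * (\<integral>\<omega>. d t \<omega> \<partial>M) + \<gamma> / 4 * (\<integral>\<omega>. (norm (e t \<omega>))\<^sup>2 \<partial>M)) + 6 * \<delta>"
      using \<gamma> by (simp add: distrib_left power2_eq_square)
    finally show ?thesis .
  qed
  then have "(\<Sum>t<T. \<integral>\<omega>. (norm (grad_surrogate \<gamma> g h (X t \<omega>)))\<^sup>2 \<partial>M)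
      \<le> (\<Sum>t<T. 126 / \<gamma> * (1 / (42 * \<gamma>) * (\<integral>\<omega>. d t \<omega> \<partial>M) + \<gamma> / 4 * (\<integral>\<omega>. (norm (e t \<omega>))\<^sup>2 \<partial>M)) + 6 * \<delta>)"
    by (intro sum_mono) simp
  also have "\<dots> = 126 / \<gamma> * ?S + T * (6 * \<delta>)"
    unfolding sum.distrib[of _ "\<lambda>_. 6 * \<delta>"] sum_distrib_left by simp
  also have "\<dots> \<le> 126 / \<gamma> * ?B + T * (6 * \<delta>)"
    using lyapunov \<gamma> by (intro add_right_mono mult_left_mono) auto
  finally have "1 / real T * (\<Sum>t<T. \<integral>\<omega>. (norm (grad_surrogate \<gamma> g h (X t \<omega>)))\<^sup>2 \<partial>M)
      \<le> 1 / real T * (126 / \<gamma> * ?B + T * (6 * \<delta>))"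
    by (intro mult_left_mono) auto
  also have "\<dots> = 126 / (\<gamma> * T) * ?B + 6 * \<delta>"
  proof -
    have "1 / real T * (126 / \<gamma> * B + T * c) = 126 / (\<gamma> * T) * B + c" for B c :: real
      using T0 by (simp add: distrib_left mult.commute)
    then show ?thesis .
  qed
  also have "\<dots> \<le> dc_rate_const * (sqrt (L * \<sigma>\<^sup>2 * \<phi>0 / real T) + L * \<phi>0 / real T + \<delta>)"
    unfolding dc_rate_const_def
    by (rule step_size_rate[OF L \<open>T \<ge> 1\<close> \<open>\<delta> \<ge> 0\<close> \<open>\<phi>0 > 0\<close> assms(25)])
  finally show ?thesis .
qed

end
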